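(* Ajax functors send adjoint monoids to adjoint monoids. That is, if $F\colon\mathbb{C}\to\mathbb{D}$ is an ajax po-functor between symmetric monoidal po-categories, with laxators $\rho\colon I\to F(I)$ and $\rho_{c,c'}\colon F(c)\otimes F(c')\to F(c\otimes c')$, and $(c,\mu,\eta)$ is an adjoint monoid in $\mathbb{C}$, then $(F(c),\ \rho_{c,c};F(\mu),\ \rho;F(\eta))$ is an adjoint monoid in $\mathbb{D}$.
   Context: $f;g$ means first $f$, then $g$. A po-category is a category enriched in posets; po-functors are poset-enriched functors. A symmetric monoidal po-category is a po-category with po-functors $\otimes, I$ whose underlying 1-structures form a symmetric monoidal category. In a po-category, $L\colon c\to d$ is left adjoint to $R\colon d\to c$ if $\mathrm{id}_c\le L;R$ and $R;L\le\mathrm{id}_d$. A po-functor $F\colon\mathbb{C}\to\mathbb{D}$ between symmetric monoidal po-categories is ajax (adjoint-lax) if it is lax symmetric monoidal (laxator naturality squares commute strictly) and its laxators are right adjoints in $\mathbb{D}$. An adjoint (commutative) monoid in a symmetric monoidal po-category is a commutative monoid object $(c,\mu\colon c\otimes c\to c,\eta\colon I\to c)$ such that $\mu$ and $\eta$ are right adjoints. *)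

theory Defs
  imports Main
begin

section \<open>Po-categories\<close>

text \<open>
  Arrows carry their domain and codomain, so distinct hom-posets are disjoint. Composition is
  written in diagrammatic order. Composition and \<open>le\<close> are total functions on the arrow type; they
  are only ever constrained or used on composable, respectively parallel, arrows of the category.
\<close>

record ('o, 'a) po_cat =
  obj :: "'o set"
  arr :: "'a set"
  src :: "'a \<Rightarrow> 'o"
  tgt :: "'a \<Rightarrow> 'o"
  ident :: "'o \<Rightarrow> 'a" ("\<one>\<index>")
  seq :: "'a \<Rightarrow> 'a \<Rightarrow> 'a" (infixl "\<Zsemi>\<index>" 60)
  le :: "'a \<Rightarrow> 'a \<Rightarrow> bool" (infix "\<sqsubseteq>\<index>" 50)

definition hom :: "('o, 'a, 'm) po_cat_scheme \<Rightarrow> 'o \<Rightarrow> 'o \<Rightarrow> 'a set" where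
  "hom C x y = {f \<in> arr C. src C f = x \<and> tgt C f = y}"

locale po_category =
  fixes C :: "('o, 'a, 'm) po_cat_scheme" (structure)
  assumes src_obj: "f \<in> arr C \<Longrightarrow> src C f \<in> obj C"
    and tgt_obj: "f \<in> arr C \<Longrightarrow> tgt C f \<in> obj C"
    and ident_hom: "x \<in> obj C \<Longrightarrow> \<one> x \<in> hom C x x"
    and seq_hom: "\<lbrakk>f \<in> hom C x y; g \<in> hom C y z\<rbrakk> \<Longrightarrow> f \<Zsemi> g \<in> hom C x z"
    and ident_seq: "f \<in> hom C x y \<Longrightarrow> \<one> x \<Zsemi> f = f"
    and seq_ident: "f \<in> hom C x y \<Longrightarrow> f \<Zsemi> \<one> y = f"
    and seq_assoc: "\<lbrakk>f \<in> hom C w x; g \<in> hom C x y; h \<in> hom C y z\<rbrakk>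
      \<Longrightarrow> (f \<Zsemi> g) \<Zsemi> h = f \<Zsemi> (g \<Zsemi> h)"
    and le_refl: "f \<in> hom C x y \<Longrightarrow> f \<sqsubseteq> f"
    and le_antisym: "\<lbrakk>f \<in> hom C x y; g \<in> hom C x y; f \<sqsubseteq> g; g \<sqsubseteq> f\<rbrakk> \<Longrightarrow> f = g"
    and le_trans: "\<lbrakk>f \<in> hom C x y; g \<in> hom C x y; h \<in> hom C x y; f \<sqsubseteq> g; g \<sqsubseteq> h\<rbrakk> \<Longrightarrow> f \<sqsubseteq> h"
    and seq_mono: "\<lbrakk>f \<in> hom C x y; f' \<in> hom C x y; g \<in> hom C y z; g' \<in> hom C y z;
        f \<sqsubseteq> f'; g \<sqsubseteq> g'\<rbrakk> \<Longrightarrow> f \<Zsemi> g \<sqsubseteq> f' \<Zsemi> g'"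

definition iso :: "('o, 'a, 'm) po_cat_scheme \<Rightarrow> 'a \<Rightarrow> 'o \<Rightarrow> 'o \<Rightarrow> bool" where
  "iso C f x y \<longleftrightarrow> f \<in> hom C x y \<and>
    (\<exists>g \<in> hom C y x. f \<Zsemi>\<^bsub>C\<^esub> g = \<one>\<^bsub>C\<^esub> x \<and> g \<Zsemi>\<^bsub>C\<^esub> f = \<one>\<^bsub>C\<^esub> y)"

definition adjunction :: "('o, 'a, 'm) po_cat_scheme \<Rightarrow> 'o \<Rightarrow> 'o \<Rightarrow> 'a \<Rightarrow> 'a \<Rightarrow> bool" where
  "adjunction C x y L R \<longleftrightarrow> L \<in> hom C x y \<and> R \<in> hom C y x \<and>
    \<one>\<^bsub>C\<^esub> x \<sqsubseteq>\<^bsub>C\<^esub> L \<Zsemi>\<^bsub>C\<^esub> R \<and> R \<Zsemi>\<^bsub>C\<^esub> L \<sqsubseteq>\<^bsub>C\<^esub> \<one>\<^bsub>C\<^esub> y"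

definition right_adjoint :: "('o, 'a, 'm) po_cat_scheme \<Rightarrow> 'a \<Rightarrow> bool" where
  "right_adjoint C R \<longleftrightarrow> (\<exists>x y L. adjunction C x y L R)"

locale po_functor = C: po_category C + D: po_category D
  for C :: "('o, 'a, 'm) po_cat_scheme" and D :: "('p, 'b, 'n) po_cat_scheme" +
  fixes Fo :: "'o \<Rightarrow> 'p" and Fa :: "'a \<Rightarrow> 'b"
  assumes functor_obj: "x \<in> obj C \<Longrightarrow> Fo x \<in> obj D"
    and functor_hom: "f \<in> hom C x y \<Longrightarrow> Fa f \<in> hom D (Fo x) (Fo y)"
    and functor_ident: "x \<in> obj C \<Longrightarrow> Fa (\<one>\<^bsub>C\<^esub> x) = \<one>\<^bsub>D\<^esub> (Fo x)"
    and functor_seq: "\<lbrakk>f \<in> hom C x y; g \<in> hom C y z\<rbrakk>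
      \<Longrightarrow> Fa (f \<Zsemi>\<^bsub>C\<^esub> g) = Fa f \<Zsemi>\<^bsub>D\<^esub> Fa g"
    and functor_mono: "\<lbrakk>f \<in> hom C x y; g \<in> hom C x y; f \<sqsubseteq>\<^bsub>C\<^esub> g\<rbrakk> \<Longrightarrow> Fa f \<sqsubseteq>\<^bsub>D\<^esub> Fa g"

definition prod_po_cat :: "('o, 'a, 'm) po_cat_scheme \<Rightarrow> ('p, 'b, 'n) po_cat_scheme
    \<Rightarrow> ('o \<times> 'p, 'a \<times> 'b) po_cat" where
  "prod_po_cat C D = \<lparr>
    obj = obj C \<times> obj D,
    arr = arr C \<times> arr D,
    src = map_prod (src C) (src D),
    tgt = map_prod (tgt C) (tgt D),
    ident = map_prod (ident C) (ident D),
    seq = (\<lambda>(f, f') (g, g'). (f \<Zsemi>\<^bsub>C\<^esub> g, f' \<Zsemi>\<^bsub>D\<^esub> g')),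
    le = (\<lambda>(f, f') (g, g'). f \<sqsubseteq>\<^bsub>C\<^esub> g \<and> f' \<sqsubseteq>\<^bsub>D\<^esub> g')\<rparr>"

section \<open>Symmetric monoidal po-categories\<close>

record ('o, 'a) sm_po_cat = "('o, 'a) po_cat" +
  tensor_obj :: "'o \<Rightarrow> 'o \<Rightarrow> 'o" (infixl "\<odot>\<index>" 70)
  tensor_arr :: "'a \<Rightarrow> 'a \<Rightarrow> 'a" (infixl "\<otimes>\<index>" 70)
  unit_obj :: "'o" ("\<I>\<index>")
  associator :: "'o \<Rightarrow> 'o \<Rightarrow> 'o \<Rightarrow> 'a" ("\<alpha>\<index>")
  left_unitor :: "'o \<Rightarrow> 'a" ("\<lambda>'_l\<index>")
  right_unitor :: "'o \<Rightarrow> 'a" ("\<lambda>'_r\<index>")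
  symmetry :: "'o \<Rightarrow> 'o \<Rightarrow> 'a" ("\<sigma>\<index>")

text \<open>
  The po-functor \<open>I\<close> from the terminal po-category is given by its value \<open>\<I>\<close>, an object. The
  structure isomorphisms are strictly natural, and subject to the usual triangle, pentagon and
  hexagon equations; the second hexagon follows from the first and \<open>symmetry_inverse\<close>.
\<close>

locale symmetric_monoidal_po_category = po_category C
  for C :: "('o, 'a, 'm) sm_po_cat_scheme" (structure) +
  assumes tensor_po_functor:
      "po_functor (prod_po_cat C C) C (case_prod (tensor_obj C)) (case_prod (tensor_arr C))"
    and unit_obj: "\<I> \<in> obj C"
    and associator_iso: "\<lbrakk>x \<in> obj C; y \<in> obj C; z \<in> obj C\<rbrakk>
      \<Longrightarrow> iso C (\<alpha> x y z) ((x \<odot> y) \<odot> z) (x \<odot> (y \<odot> z))"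
    and associator_natural: "\<lbrakk>f \<in> hom C x x'; g \<in> hom C y y'; h \<in> hom C z z'\<rbrakk>
      \<Longrightarrow> ((f \<otimes> g) \<otimes> h) \<Zsemi> \<alpha> x' y' z' = \<alpha> x y z \<Zsemi> (f \<otimes> (g \<otimes> h))"
    and left_unitor_iso: "x \<in> obj C \<Longrightarrow> iso C (\<lambda>_l x) (\<I> \<odot> x) x"
    and left_unitor_natural: "f \<in> hom C x x' \<Longrightarrow> (\<one> \<I> \<otimes> f) \<Zsemi> \<lambda>_l x' = \<lambda>_l x \<Zsemi> f"
    and right_unitor_iso: "x \<in> obj C \<Longrightarrow> iso C (\<lambda>_r x) (x \<odot> \<I>) x"
    and right_unitor_natural: "f \<in> hom C x x' \<Longrightarrow> (f \<otimes> \<one> \<I>) \<Zsemi> \<lambda>_r x' = \<lambda>_r x \<Zsemi> f"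
    and symmetry_hom: "\<lbrakk>x \<in> obj C; y \<in> obj C\<rbrakk> \<Longrightarrow> \<sigma> x y \<in> hom C (x \<odot> y) (y \<odot> x)"
    and symmetry_natural: "\<lbrakk>f \<in> hom C x x'; g \<in> hom C y y'\<rbrakk>
      \<Longrightarrow> (f \<otimes> g) \<Zsemi> \<sigma> x' y' = \<sigma> x y \<Zsemi> (g \<otimes> f)"
    and symmetry_inverse: "\<lbrakk>x \<in> obj C; y \<in> obj C\<rbrakk> \<Longrightarrow> \<sigma> x y \<Zsemi> \<sigma> y x = \<one> (x \<odot> y)"
    and triangle: "\<lbrakk>x \<in> obj C; y \<in> obj C\<rbrakk>
      \<Longrightarrow> \<alpha> x \<I> y \<Zsemi> (\<one> x \<otimes> \<lambda>_l y) = \<lambda>_r x \<otimes> \<one> y"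
    and pentagon: "\<lbrakk>w \<in> obj C; x \<in> obj C; y \<in> obj C; z \<in> obj C\<rbrakk>
      \<Longrightarrow> (\<alpha> w x y \<otimes> \<one> z) \<Zsemi> \<alpha> w (x \<odot> y) z \<Zsemi> (\<one> w \<otimes> \<alpha> x y z)
        = \<alpha> (w \<odot> x) y z \<Zsemi> \<alpha> w x (y \<odot> z)"
    and hexagon: "\<lbrakk>x \<in> obj C; y \<in> obj C; z \<in> obj C\<rbrakk>
      \<Longrightarrow> \<alpha> x y z \<Zsemi> \<sigma> x (y \<odot> z) \<Zsemi> \<alpha> y z x
        = (\<sigma> x y \<otimes> \<one> z) \<Zsemi> \<alpha> y x z \<Zsemi> (\<one> y \<otimes> \<sigma> x z)"

section \<open>Ajax po-functors\<close>

locale lax_symmetric_monoidal_po_functor =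
  C: symmetric_monoidal_po_category C + D: symmetric_monoidal_po_category D + po_functor C D Fo Fa
  for C :: "('o, 'a, 'm) sm_po_cat_scheme" and D :: "('p, 'b, 'n) sm_po_cat_scheme"
    and Fo :: "'o \<Rightarrow> 'p" and Fa :: "'a \<Rightarrow> 'b" +
  fixes \<rho>0 :: "'b" and \<rho> :: "'o \<Rightarrow> 'o \<Rightarrow> 'b"
  assumes unit_laxator_hom: "\<rho>0 \<in> hom D \<I>\<^bsub>D\<^esub> (Fo \<I>\<^bsub>C\<^esub>)"
    and laxator_hom: "\<lbrakk>x \<in> obj C; y \<in> obj C\<rbrakk>
      \<Longrightarrow> \<rho> x y \<in> hom D (Fo x \<odot>\<^bsub>D\<^esub> Fo y) (Fo (x \<odot>\<^bsub>C\<^esub> y))"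
    and laxator_natural: "\<lbrakk>f \<in> hom C x x'; g \<in> hom C y y'\<rbrakk>
      \<Longrightarrow> (Fa f \<otimes>\<^bsub>D\<^esub> Fa g) \<Zsemi>\<^bsub>D\<^esub> \<rho> x' y' = \<rho> x y \<Zsemi>\<^bsub>D\<^esub> Fa (f \<otimes>\<^bsub>C\<^esub> g)"
    and lax_associator: "\<lbrakk>x \<in> obj C; y \<in> obj C; z \<in> obj C\<rbrakk>
      \<Longrightarrow> (\<rho> x y \<otimes>\<^bsub>D\<^esub> \<one>\<^bsub>D\<^esub> (Fo z)) \<Zsemi>\<^bsub>D\<^esub> \<rho> (x \<odot>\<^bsub>C\<^esub> y) z \<Zsemi>\<^bsub>D\<^esub> Fa (\<alpha>\<^bsub>C\<^esub> x y z)
        = \<alpha>\<^bsub>D\<^esub> (Fo x) (Fo y) (Fo z)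
            \<Zsemi>\<^bsub>D\<^esub> (\<one>\<^bsub>D\<^esub> (Fo x) \<otimes>\<^bsub>D\<^esub> \<rho> y z) \<Zsemi>\<^bsub>D\<^esub> \<rho> x (y \<odot>\<^bsub>C\<^esub> z)"
    and lax_left_unitor: "x \<in> obj C
      \<Longrightarrow> (\<rho>0 \<otimes>\<^bsub>D\<^esub> \<one>\<^bsub>D\<^esub> (Fo x)) \<Zsemi>\<^bsub>D\<^esub> \<rho> \<I>\<^bsub>C\<^esub> x \<Zsemi>\<^bsub>D\<^esub> Fa (\<lambda>_l\<^bsub>C\<^esub> x) = \<lambda>_l\<^bsub>D\<^esub> (Fo x)"
    and lax_right_unitor: "x \<in> obj C
      \<Longrightarrow> (\<one>\<^bsub>D\<^esub> (Fo x) \<otimes>\<^bsub>D\<^esub> \<rho>0) \<Zsemi>\<^bsub>D\<^esub> \<rho> x \<I>\<^bsub>C\<^esub> \<Zsemi>\<^bsub>D\<^esub> Fa (\<lambda>_r\<^bsub>C\<^esub> x) = \<lambda>_r\<^bsub>D\<^esub> (Fo x)"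
    and lax_symmetry: "\<lbrakk>x \<in> obj C; y \<in> obj C\<rbrakk>
      \<Longrightarrow> \<rho> x y \<Zsemi>\<^bsub>D\<^esub> Fa (\<sigma>\<^bsub>C\<^esub> x y) = \<sigma>\<^bsub>D\<^esub> (Fo x) (Fo y) \<Zsemi>\<^bsub>D\<^esub> \<rho> y x"

locale ajax_po_functor = lax_symmetric_monoidal_po_functor +
  assumes unit_laxator_right_adjoint: "right_adjoint D \<rho>0"
    and laxator_right_adjoint: "\<lbrakk>x \<in> obj C; y \<in> obj C\<rbrakk> \<Longrightarrow> right_adjoint D (\<rho> x y)"

section \<open>Adjoint monoids\<close>

locale commutative_monoid_object = symmetric_monoidal_po_category C
  for C :: "('o, 'a, 'm) sm_po_cat_scheme" (structure) +
  fixes c :: 'o and \<mu> :: 'a and \<eta> :: 'a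
  assumes carrier_obj: "c \<in> obj C"
    and mult_hom: "\<mu> \<in> hom C (c \<odot> c) c"
    and unit_hom: "\<eta> \<in> hom C \<I> c"
    and mult_assoc: "(\<mu> \<otimes> \<one> c) \<Zsemi> \<mu> = \<alpha> c c c \<Zsemi> (\<one> c \<otimes> \<mu>) \<Zsemi> \<mu>"
    and mult_left_unit: "(\<eta> \<otimes> \<one> c) \<Zsemi> \<mu> = \<lambda>_l c"
    and mult_right_unit: "(\<one> c \<otimes> \<eta>) \<Zsemi> \<mu> = \<lambda>_r c"
    and mult_comm: "\<sigma> c c \<Zsemi> \<mu> = \<mu>"

locale adjoint_monoid = commutative_monoid_object +
  assumes mult_right_adjoint: "right_adjoint C \<mu>"
    and unit_right_adjoint: "right_adjoint C \<eta>"

end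

theory Submission
  imports Defs
begin

text \<open>
  A map out of a tensor product of objects of the form \<open>F x\<close> that is built from the laxator and
  maps in the image of \<open>F\<close> can be rewritten, by naturality of the laxator, so that the laxators come
  first and a single arrow in the image of \<open>F\<close> comes last (\<open>laxator_seq_functor\<close>). Each monoid law
  for \<open>F c\<close> thus reduces to a coherence law of the laxators followed by the image under \<open>F\<close> of the
  corresponding law for \<open>c\<close>. Right adjointness survives because right adjoints compose and are
  preserved by po-functors.
\<close>

text \<open>Lets the po-functor axioms of the tensor, stated over the product category, be applied
  to pairs of arrows component by component.\<close>

lemma hom_prod_po_cat: "hom (prod_po_cat C D) (x, x') (y, y') = hom C x y \<times> hom D x' y'"
  by (auto simp: hom_def prod_po_cat_def)

text \<open>\<open>right_adjoint\<close> hides the endpoints behind an existential quantifier.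
  Arrows determine their source and target, so the hidden endpoints are the known ones; this is what
  later makes two adjunctions visibly composable.\<close>

lemma right_adjoint_homE:
  assumes "right_adjoint C R" "R \<in> hom C y x"
  obtains L where "adjunction C x y L R"
proof -
  obtain x' y' L where L: "adjunction C x' y' L R"
    using assms(1) unfolding right_adjoint_def by blast
  with assms(2) have "x' = x" "y' = y"
    by (auto simp: adjunction_def hom_def)
  with L that show thesis by blast
qed

section \<open>Adjunctions under composition and po-functors\<close>

context po_category
begin

lemma hom_objD:
  assumes "f \<in> hom C x y"
  shows "x \<in> obj C" "y \<in> obj C"
  using assms src_obj tgt_obj by (auto simp: hom_def)

text \<open>The unit whiskered by \<open>f\<close> and \<open>g\<close>, by monotonicity of
  composition on both sides; the identity in the middle is absorbed into \<open>f\<close>.\<close>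

lemma adjunction_insert_unit:
  assumes adj: "adjunction C x y L R" and f: "f \<in> hom C w x" and g: "g \<in> hom C x z"
  shows "f \<Zsemi> g \<sqsubseteq> f \<Zsemi> (L \<Zsemi> R) \<Zsemi> g"
proof -
  have LR: "L \<Zsemi> R \<in> hom C x x" and unit: "\<one> x \<sqsubseteq> L \<Zsemi> R"
    using adj unfolding adjunction_def by (auto intro: seq_hom)
  have one: "\<one> x \<in> hom C x x"
    using f by (intro ident_hom hom_objD)
  have "f \<Zsemi> \<one> x \<sqsubseteq> f \<Zsemi> (L \<Zsemi> R)"
    using seq_mono[OF f f one LR le_refl[OF f] unit] .
  from seq_mono[OF seq_hom[OF f one] seq_hom[OF f LR] g g this le_refl[OF g]]
  show ?thesis by (simp add: seq_ident[OF f])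
qed

lemma adjunction_delete_counit:
  assumes adj: "adjunction C x y L R" and f: "f \<in> hom C w y" and g: "g \<in> hom C y z"
  shows "f \<Zsemi> (R \<Zsemi> L) \<Zsemi> g \<sqsubseteq> f \<Zsemi> g"
proof -
  have RL: "R \<Zsemi> L \<in> hom C y y" and counit: "R \<Zsemi> L \<sqsubseteq> \<one> y"
    using adj unfolding adjunction_def by (auto intro: seq_hom)
  have one: "\<one> y \<in> hom C y y"
    using f by (intro ident_hom hom_objD)
  have "f \<Zsemi> (R \<Zsemi> L) \<sqsubseteq> f \<Zsemi> \<one> y"
    using seq_mono[OF f f RL one le_refl[OF f] counit] .
  from seq_mono[OF seq_hom[OF f RL] seq_hom[OF f one] g g this le_refl[OF g]]
  show ?thesis by (simp add: seq_ident[OF f])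
qed

text \<open>The unit is the chain \<one> \<sqsubseteq> K \<Zsemi> S \<sqsubseteq> K \<Zsemi> (L
  \<Zsemi> R) \<Zsemi> S, nesting the second unit inside the first. Dually, the counit deletes S
  \<Zsemi> K from R \<Zsemi> (S \<Zsemi> K) \<Zsemi> L and then R \<Zsemi> L.\<close>

lemma adjunction_seq:
  assumes adjK: "adjunction C w x K S" and adjL: "adjunction C x y L R"
  shows "adjunction C w y (K \<Zsemi> L) (R \<Zsemi> S)"
proof -
  have K: "K \<in> hom C w x" and S: "S \<in> hom C x w" and L: "L \<in> hom C x y" and R: "R \<in> hom C y x"
    and unitK: "\<one> w \<sqsubseteq> K \<Zsemi> S" and counitL: "R \<Zsemi> L \<sqsubseteq> \<one> y"
    using adjK adjL by (auto simp: adjunction_def)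
  note KS = seq_hom[OF K S] and RL = seq_hom[OF R L]
  note KL = seq_hom[OF K L] and RS = seq_hom[OF R S]
  have "K \<Zsemi> (L \<Zsemi> R) \<Zsemi> S = (K \<Zsemi> L) \<Zsemi> (R \<Zsemi> S)"
    by (simp add: seq_assoc[OF K L R, symmetric] seq_assoc[OF KL R S])
  with adjunction_insert_unit[OF adjL K S] have "K \<Zsemi> S \<sqsubseteq> (K \<Zsemi> L) \<Zsemi> (R \<Zsemi> S)"
    by simp
  with unitK have unit: "\<one> w \<sqsubseteq> (K \<Zsemi> L) \<Zsemi> (R \<Zsemi> S)"
    by (rule le_trans[OF ident_hom[OF hom_objD(1)[OF K]] KS seq_hom[OF KL RS]])
  have "R \<Zsemi> (S \<Zsemi> K) \<Zsemi> L = (R \<Zsemi> S) \<Zsemi> (K \<Zsemi> L)"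
    by (simp add: seq_assoc[OF R S K, symmetric] seq_assoc[OF RS K L])
  with adjunction_delete_counit[OF adjK R L] have "(R \<Zsemi> S) \<Zsemi> (K \<Zsemi> L) \<sqsubseteq> R \<Zsemi> L"
    by simp
  from this counitL have counit: "(R \<Zsemi> S) \<Zsemi> (K \<Zsemi> L) \<sqsubseteq> \<one> y"
    by (rule le_trans[OF seq_hom[OF RS KL] RL ident_hom[OF hom_objD(2)[OF L]]])
  show ?thesis
    using KL RS unit counit by (simp add: adjunction_def)
qed

lemma right_adjoint_seq:
  assumes "right_adjoint C R" "R \<in> hom C y x" "right_adjoint C S" "S \<in> hom C x w"
  shows "right_adjoint C (R \<Zsemi> S)"
proof -
  obtain L where "adjunction C x y L R"
    using assms(1,2) by (rule right_adjoint_homE)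
  moreover obtain K where "adjunction C w x K S"
    using assms(3,4) by (rule right_adjoint_homE)
  ultimately show ?thesis
    unfolding right_adjoint_def using adjunction_seq by blast
qed

end

text \<open>Unit and counit are inequalities between composites and identities, so monotonicity and
  functoriality carry them to \<open>D\<close>, with \<open>Fa L\<close> as the left
  adjoint.\<close>

lemma (in po_functor) functor_right_adjoint:
  assumes "right_adjoint C R"
  shows "right_adjoint D (Fa R)"
proof -
  obtain x y L where adj: "adjunction C x y L R"
    using assms unfolding right_adjoint_def by blast
  then have L: "L \<in> hom C x y" and R: "R \<in> hom C y x"
    and unit: "\<one>\<^bsub>C\<^esub> x \<sqsubseteq>\<^bsub>C\<^esub> L \<Zsemi>\<^bsub>C\<^esub> R" and counit: "R \<Zsemi>\<^bsub>C\<^esub> L \<sqsubseteq>\<^bsub>C\<^esub> \<one>\<^bsub>C\<^esub> y"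
    by (auto simp: adjunction_def)
  have x: "x \<in> obj C" and y: "y \<in> obj C"
    using C.hom_objD[OF L] .
  have "adjunction D (Fo x) (Fo y) (Fa L) (Fa R)"
    using functor_mono[OF C.ident_hom[OF x] C.seq_hom[OF L R] unit]
      functor_mono[OF C.seq_hom[OF R L] C.ident_hom[OF y] counit]
    by (simp add: adjunction_def functor_hom L R x y functor_seq[OF L R] functor_seq[OF R L]
        functor_ident)
  then show ?thesis
    unfolding right_adjoint_def by blast
qed

section \<open>The tensor po-functor in terms of single arrows\<close>

context symmetric_monoidal_po_category
begin

lemma tensor_obj_closed: "\<lbrakk>x \<in> obj C; y \<in> obj C\<rbrakk> \<Longrightarrow> x \<odot> y \<in> obj C"
  using po_functor.functor_obj[OF tensor_po_functor, of "(x, y)"]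
  by (simp add: prod_po_cat_def)

lemma tensor_hom: "\<lbrakk>f \<in> hom C x x'; g \<in> hom C y y'\<rbrakk> \<Longrightarrow> f \<otimes> g \<in> hom C (x \<odot> y) (x' \<odot> y')"
  using po_functor.functor_hom[OF tensor_po_functor, of "(f, g)" "(x, y)" "(x', y')"]
  by (simp add: hom_prod_po_cat)

text \<open>The interchange law: functoriality of the tensor on the product category.\<close>

lemma tensor_seq:
  assumes "f \<in> hom C x x'" "f' \<in> hom C x' x''" "g \<in> hom C y y'" "g' \<in> hom C y' y''"
  shows "(f \<Zsemi> f') \<otimes> (g \<Zsemi> g') = (f \<otimes> g) \<Zsemi> (f' \<otimes> g')"
  using po_functor.functor_seq[OF tensor_po_functor,
      of "(f, g)" "(x, y)" "(x', y')" "(f', g')" "(x'', y'')"] assms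
  by (simp add: hom_prod_po_cat) (simp add: prod_po_cat_def)

lemma associator_hom:
  "\<lbrakk>x \<in> obj C; y \<in> obj C; z \<in> obj C\<rbrakk> \<Longrightarrow> \<alpha> x y z \<in> hom C ((x \<odot> y) \<odot> z) (x \<odot> (y \<odot> z))"
  using associator_iso by (simp add: iso_def)

end

section \<open>Transport of the monoid laws\<close>

context lax_symmetric_monoidal_po_functor
begin

text \<open>Interchange splits off \<open>p\<close> \<otimes> \<open>q\<close>, naturality carries
  \<open>Fa f\<close> \<otimes> \<open>Fa g\<close> across the laxator, and functoriality merges the
  result with \<open>Fa h\<close>.\<close>

lemma laxator_seq_functor:
  assumes p: "p \<in> hom D a (Fo x)" and f: "f \<in> hom C x x'"
    and q: "q \<in> hom D b (Fo y)" and g: "g \<in> hom C y y'"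
    and h: "h \<in> hom C (x' \<odot>\<^bsub>C\<^esub> y') z"
  shows "((p \<Zsemi>\<^bsub>D\<^esub> Fa f) \<otimes>\<^bsub>D\<^esub> (q \<Zsemi>\<^bsub>D\<^esub> Fa g)) \<Zsemi>\<^bsub>D\<^esub> (\<rho> x' y' \<Zsemi>\<^bsub>D\<^esub> Fa h)
    = (p \<otimes>\<^bsub>D\<^esub> q) \<Zsemi>\<^bsub>D\<^esub> \<rho> x y \<Zsemi>\<^bsub>D\<^esub> Fa ((f \<otimes>\<^bsub>C\<^esub> g) \<Zsemi>\<^bsub>C\<^esub> h)"
proof -
  note Ff = functor_hom[OF f] and Fg = functor_hom[OF g] and Fh = functor_hom[OF h]
  note pq = D.tensor_hom[OF p q] and FfFg = D.tensor_hom[OF Ff Fg] and fg = C.tensor_hom[OF f g]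
  have r: "\<rho> x y \<in> hom D (Fo x \<odot>\<^bsub>D\<^esub> Fo y) (Fo (x \<odot>\<^bsub>C\<^esub> y))"
    and r': "\<rho> x' y' \<in> hom D (Fo x' \<odot>\<^bsub>D\<^esub> Fo y') (Fo (x' \<odot>\<^bsub>C\<^esub> y'))"
    using C.hom_objD[OF f] C.hom_objD[OF g] by (auto intro: laxator_hom)
  have "((p \<Zsemi>\<^bsub>D\<^esub> Fa f) \<otimes>\<^bsub>D\<^esub> (q \<Zsemi>\<^bsub>D\<^esub> Fa g)) \<Zsemi>\<^bsub>D\<^esub> (\<rho> x' y' \<Zsemi>\<^bsub>D\<^esub> Fa h)
    = (p \<otimes>\<^bsub>D\<^esub> q) \<Zsemi>\<^bsub>D\<^esub> (((Fa f \<otimes>\<^bsub>D\<^esub> Fa g) \<Zsemi>\<^bsub>D\<^esub> \<rho> x' y') \<Zsemi>\<^bsub>D\<^esub> Fa h)"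
    by (simp add: D.tensor_seq[OF p Ff q Fg] D.seq_assoc[OF pq FfFg D.seq_hom[OF r' Fh]]
        D.seq_assoc[OF FfFg r' Fh])
  also have "\<dots> = (p \<otimes>\<^bsub>D\<^esub> q) \<Zsemi>\<^bsub>D\<^esub> \<rho> x y \<Zsemi>\<^bsub>D\<^esub> Fa ((f \<otimes>\<^bsub>C\<^esub> g) \<Zsemi>\<^bsub>C\<^esub> h)"
    by (simp add: laxator_natural[OF f g] functor_seq[OF fg h]
        D.seq_assoc[OF r functor_hom[OF fg] Fh]
        D.seq_assoc[OF pq r D.seq_hom[OF functor_hom[OF fg] Fh]])
  finally show ?thesis .
qed

lemma functor_commutative_monoid_object:
  assumes "commutative_monoid_object C c \<mu> \<eta>"
  shows "commutative_monoid_object D (Fo c) (\<rho> c c \<Zsemi>\<^bsub>D\<^esub> Fa \<mu>) (\<rho>0 \<Zsemi>\<^bsub>D\<^esub> Fa \<eta>)"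
proof -
  interpret M: commutative_monoid_object C c \<mu> \<eta> by fact
  note c = M.carrier_obj
  note cc = C.tensor_obj_closed[OF c c]
  note Fc = functor_obj[OF c]
  note one = C.ident_hom[OF c] and Fone = D.ident_hom[OF Fc]
  note r = laxator_hom[OF c c] and F\<mu> = functor_hom[OF M.mult_hom]
  note m = D.seq_hom[OF r F\<mu>]
  \<comment> \<open>Writes an identity factor in the shape required by
    \<open>laxator_seq_functor\<close>, so that \<open>left\<close> and \<open>right\<close> are its
    instances with one trivial tensor factor and \<open>h\<close> = \<mu>.\<close>
  have Fone_eq: "\<one>\<^bsub>D\<^esub> (Fo c) \<Zsemi>\<^bsub>D\<^esub> Fa (\<one>\<^bsub>C\<^esub> c) = \<one>\<^bsub>D\<^esub> (Fo c)"
    by (simp add: functor_ident[OF c] D.ident_seq[OF Fone])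
  have left: "((p \<Zsemi>\<^bsub>D\<^esub> Fa f) \<otimes>\<^bsub>D\<^esub> \<one>\<^bsub>D\<^esub> (Fo c)) \<Zsemi>\<^bsub>D\<^esub> (\<rho> c c \<Zsemi>\<^bsub>D\<^esub> Fa \<mu>)
      = (p \<otimes>\<^bsub>D\<^esub> \<one>\<^bsub>D\<^esub> (Fo c)) \<Zsemi>\<^bsub>D\<^esub> \<rho> x c \<Zsemi>\<^bsub>D\<^esub> Fa ((f \<otimes>\<^bsub>C\<^esub> \<one>\<^bsub>C\<^esub> c) \<Zsemi>\<^bsub>C\<^esub> \<mu>)"
    if "p \<in> hom D a (Fo x)" "f \<in> hom C x c" for p a f x
    using laxator_seq_functor[OF that Fone one M.mult_hom] by (simp add: Fone_eq)
  have right: "(\<one>\<^bsub>D\<^esub> (Fo c) \<otimes>\<^bsub>D\<^esub> (q \<Zsemi>\<^bsub>D\<^esub> Fa g)) \<Zsemi>\<^bsub>D\<^esub> (\<rho> c c \<Zsemi>\<^bsub>D\<^esub> Fa \<mu>)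
      = (\<one>\<^bsub>D\<^esub> (Fo c) \<otimes>\<^bsub>D\<^esub> q) \<Zsemi>\<^bsub>D\<^esub> \<rho> c y \<Zsemi>\<^bsub>D\<^esub> Fa ((\<one>\<^bsub>C\<^esub> c \<otimes>\<^bsub>C\<^esub> g) \<Zsemi>\<^bsub>C\<^esub> \<mu>)"
    if "q \<in> hom D b (Fo y)" "g \<in> hom C y c" for q b g y
    using laxator_seq_functor[OF Fone one that M.mult_hom] by (simp add: Fone_eq)
  show ?thesis
  proof unfold_locales
    show "Fo c \<in> obj D" by (rule Fc)
    show "\<rho> c c \<Zsemi>\<^bsub>D\<^esub> Fa \<mu> \<in> hom D (Fo c \<odot>\<^bsub>D\<^esub> Fo c) (Fo c)" by (rule m)
    show "\<rho>0 \<Zsemi>\<^bsub>D\<^esub> Fa \<eta> \<in> hom D \<I>\<^bsub>D\<^esub> (Fo c)"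
      by (rule D.seq_hom[OF unit_laxator_hom functor_hom[OF M.unit_hom]])
  next
    \<comment> \<open>Associativity in \<open>C\<close> gives (\<mu> \<otimes> \<one>) \<Zsemi>
      \<mu> = \<alpha> \<Zsemi> \<open>?t\<close>. The image of \<alpha> is then absorbed by
      \<open>lax_associator\<close>, and the remaining image of \<open>?t\<close> is unfolded by
      \<open>right\<close>, read backwards, into the other bracketing.\<close>
    let ?t = "(\<one>\<^bsub>C\<^esub> c \<otimes>\<^bsub>C\<^esub> \<mu>) \<Zsemi>\<^bsub>C\<^esub> \<mu>"
    note a = C.associator_hom[OF c c c]
    note one_\<mu> = C.tensor_hom[OF one M.mult_hom]
    note t = C.seq_hom[OF one_\<mu> M.mult_hom]
    note rl = laxator_hom[OF cc c] and rr = laxator_hom[OF c cc]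
    note r_one = D.tensor_hom[OF r Fone] and one_r = D.tensor_hom[OF Fone r]
    note aD = D.associator_hom[OF Fc Fc Fc]
    have "((\<rho> c c \<Zsemi>\<^bsub>D\<^esub> Fa \<mu>) \<otimes>\<^bsub>D\<^esub> \<one>\<^bsub>D\<^esub> (Fo c)) \<Zsemi>\<^bsub>D\<^esub> (\<rho> c c \<Zsemi>\<^bsub>D\<^esub> Fa \<mu>)
        = (\<rho> c c \<otimes>\<^bsub>D\<^esub> \<one>\<^bsub>D\<^esub> (Fo c)) \<Zsemi>\<^bsub>D\<^esub> \<rho> (c \<odot>\<^bsub>C\<^esub> c) c \<Zsemi>\<^bsub>D\<^esub> Fa (\<alpha>\<^bsub>C\<^esub> c c c \<Zsemi>\<^bsub>C\<^esub> ?t)"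
      by (simp add: left[OF r M.mult_hom] M.mult_assoc C.seq_assoc[OF a one_\<mu> M.mult_hom])
    also have "\<dots> = (\<rho> c c \<otimes>\<^bsub>D\<^esub> \<one>\<^bsub>D\<^esub> (Fo c)) \<Zsemi>\<^bsub>D\<^esub> \<rho> (c \<odot>\<^bsub>C\<^esub> c) c \<Zsemi>\<^bsub>D\<^esub> Fa (\<alpha>\<^bsub>C\<^esub> c c c) \<Zsemi>\<^bsub>D\<^esub> Fa ?t"
      by (simp add: functor_seq[OF a t]
          D.seq_assoc[OF D.seq_hom[OF r_one rl] functor_hom[OF a] functor_hom[OF t]])
    also have "\<dots> = \<alpha>\<^bsub>D\<^esub> (Fo c) (Fo c) (Fo c)
        \<Zsemi>\<^bsub>D\<^esub> ((\<one>\<^bsub>D\<^esub> (Fo c) \<otimes>\<^bsub>D\<^esub> \<rho> c c) \<Zsemi>\<^bsub>D\<^esub> \<rho> c (c \<odot>\<^bsub>C\<^esub> c) \<Zsemi>\<^bsub>D\<^esub> Fa ?t)"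
      by (simp add: lax_associator[OF c c c] D.seq_assoc[OF aD one_r rr]
          D.seq_assoc[OF aD D.seq_hom[OF one_r rr] functor_hom[OF t]])
    also have "\<dots> = \<alpha>\<^bsub>D\<^esub> (Fo c) (Fo c) (Fo c)
        \<Zsemi>\<^bsub>D\<^esub> (\<one>\<^bsub>D\<^esub> (Fo c) \<otimes>\<^bsub>D\<^esub> (\<rho> c c \<Zsemi>\<^bsub>D\<^esub> Fa \<mu>)) \<Zsemi>\<^bsub>D\<^esub> (\<rho> c c \<Zsemi>\<^bsub>D\<^esub> Fa \<mu>)"
      by (simp add: right[OF r M.mult_hom] D.seq_assoc[OF aD D.tensor_hom[OF Fone m] m])
    finally show "((\<rho> c c \<Zsemi>\<^bsub>D\<^esub> Fa \<mu>) \<otimes>\<^bsub>D\<^esub> \<one>\<^bsub>D\<^esub> (Fo c)) \<Zsemi>\<^bsub>D\<^esub> (\<rho> c c \<Zsemi>\<^bsub>D\<^esub> Fa \<mu>)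
      = \<alpha>\<^bsub>D\<^esub> (Fo c) (Fo c) (Fo c)
        \<Zsemi>\<^bsub>D\<^esub> (\<one>\<^bsub>D\<^esub> (Fo c) \<otimes>\<^bsub>D\<^esub> (\<rho> c c \<Zsemi>\<^bsub>D\<^esub> Fa \<mu>)) \<Zsemi>\<^bsub>D\<^esub> (\<rho> c c \<Zsemi>\<^bsub>D\<^esub> Fa \<mu>)" .
  next
    \<comment> \<open>Collecting laxators leaves the image of (\<eta> \<otimes> \<one>) \<Zsemi>
      \<mu>, which is the image of the left unitor; \<open>lax_left_unitor\<close> finishes. The
      right unit law is the mirror image.\<close>
    show "((\<rho>0 \<Zsemi>\<^bsub>D\<^esub> Fa \<eta>) \<otimes>\<^bsub>D\<^esub> \<one>\<^bsub>D\<^esub> (Fo c)) \<Zsemi>\<^bsub>D\<^esub> (\<rho> c c \<Zsemi>\<^bsub>D\<^esub> Fa \<mu>) = \<lambda>_l\<^bsub>D\<^esub> (Fo c)"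
      by (simp add: left[OF unit_laxator_hom M.unit_hom] M.mult_left_unit lax_left_unitor[OF c])
    show "(\<one>\<^bsub>D\<^esub> (Fo c) \<otimes>\<^bsub>D\<^esub> (\<rho>0 \<Zsemi>\<^bsub>D\<^esub> Fa \<eta>)) \<Zsemi>\<^bsub>D\<^esub> (\<rho> c c \<Zsemi>\<^bsub>D\<^esub> Fa \<mu>) = \<lambda>_r\<^bsub>D\<^esub> (Fo c)"
      by (simp add: right[OF unit_laxator_hom M.unit_hom] M.mult_right_unit lax_right_unitor[OF c])
  next
    \<comment> \<open>\<open>lax_symmetry\<close> trades the symmetry of \<open>D\<close> before the
      laxator for the image of the symmetry of \<open>C\<close> after it, where commutativity of
      \<mu> absorbs it.\<close>
    note s = C.symmetry_hom[OF c c] and sD = D.symmetry_hom[OF Fc Fc]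
    have "\<sigma>\<^bsub>D\<^esub> (Fo c) (Fo c) \<Zsemi>\<^bsub>D\<^esub> (\<rho> c c \<Zsemi>\<^bsub>D\<^esub> Fa \<mu>) = \<rho> c c \<Zsemi>\<^bsub>D\<^esub> Fa (\<sigma>\<^bsub>C\<^esub> c c) \<Zsemi>\<^bsub>D\<^esub> Fa \<mu>"
      by (simp add: D.seq_assoc[OF sD r F\<mu>] lax_symmetry[OF c c])
    also have "\<dots> = \<rho> c c \<Zsemi>\<^bsub>D\<^esub> Fa \<mu>"
      by (simp add: D.seq_assoc[OF r functor_hom[OF s] F\<mu>] functor_seq[OF s M.mult_hom, symmetric]
          M.mult_comm)
    finally show "\<sigma>\<^bsub>D\<^esub> (Fo c) (Fo c) \<Zsemi>\<^bsub>D\<^esub> (\<rho> c c \<Zsemi>\<^bsub>D\<^esub> Fa \<mu>) = \<rho> c c \<Zsemi>\<^bsub>D\<^esub> Fa \<mu>" .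
  qed
qed

end

theorem proposition3p6:
  fixes C :: "('o, 'a, 'm) sm_po_cat_scheme" and D :: "('p, 'b, 'n) sm_po_cat_scheme"
    and Fo :: "'o \<Rightarrow> 'p" and Fa :: "'a \<Rightarrow> 'b"
    and \<rho>0 :: "'b" and \<rho> :: "'o \<Rightarrow> 'o \<Rightarrow> 'b"
    and c :: "'o" and \<mu> \<eta> :: "'a"
  assumes "symmetric_monoidal_po_category C" and "symmetric_monoidal_po_category D"
    and "ajax_po_functor C D Fo Fa \<rho>0 \<rho>"
    and "adjoint_monoid C c \<mu> \<eta>"
  shows "adjoint_monoid D (Fo c) (\<rho> c c \<Zsemi>\<^bsub>D\<^esub> Fa \<mu>) (\<rho>0 \<Zsemi>\<^bsub>D\<^esub> Fa \<eta>)"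
proof -
  interpret F: ajax_po_functor C D Fo Fa \<rho>0 \<rho> by fact
  interpret M: adjoint_monoid C c \<mu> \<eta> by fact
  note c = M.carrier_obj
  \<comment> \<open>The laxator is a right adjoint by ajaxness, and \<open>Fa \<mu>\<close> is one
    because po-functors preserve adjunctions; the hom facts align their endpoints for
    composition.\<close>
  have "right_adjoint D (\<rho> c c \<Zsemi>\<^bsub>D\<^esub> Fa \<mu>)"
    by (rule F.D.right_adjoint_seq[OF F.laxator_right_adjoint[OF c c] F.laxator_hom[OF c c]
          F.functor_right_adjoint[OF M.mult_right_adjoint] F.functor_hom[OF M.mult_hom]])
  moreover have "right_adjoint D (\<rho>0 \<Zsemi>\<^bsub>D\<^esub> Fa \<eta>)"
    by (rule F.D.right_adjoint_seq[OF F.unit_laxator_right_adjoint F.unit_laxator_hom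
          F.functor_right_adjoint[OF M.unit_right_adjoint] F.functor_hom[OF M.unit_hom]])
  ultimately show ?thesis
    using F.functor_commutative_monoid_object[OF M.commutative_monoid_object_axioms]
    by (simp add: adjoint_monoid_def adjoint_monoid_axioms_def)
qed

end
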